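(* Let $f:\mathbb{R}^n\to\mathbb{R}$ be twice continuously differentiable and bounded below by $f_{\mathrm{low}}$, and consider an infinite run of the algorithm described in the context (ARC with dynamic Hessian accuracy), with $\alpha\in\left[0,\frac23\right)$ and $\eta_2\in\left(0,\frac{2-3\alpha}{2}\right)$. Suppose that, for constants $L>0$ and $\kappa_B\ge0$ and for all $k\ge 0$, $\|\nabla^2 f(x_k+\beta s_k)-\nabla^2 f(x_k)\|\le L\beta\|s_k\|$ for all $\beta\in[0,1]$, and $\|B_k\|\le\kappa_B$. Suppose that one of the following holds: (a) the steps satisfy $\|\nabla_s m(x_k,s_k,\sigma_k)\|\le\theta\min\left(\|s_k\|^2,\|\nabla f(x_k)\|\right)$; or (b) the steps satisfy $\|\nabla_s m(x_k,s_k,\sigma_k)\|\le\theta\min(1,\|s_k\|)\,\|\nabla f(x_k)\|$, and there is a constant $\kappa_H$ with $\|\nabla^2 f(x_k+\beta s_k)\|\le\kappa_H$ for all $k\ge0$ and $\beta\in[0,1]$. Then the steps $s_k$ and the iterates $x_k$ satisfy $$\|s_k\|\to0\quad\text{as }k\to\infty,\ k\in\mathcal S,\qquad\text{and}\qquad \|\nabla f(x_k)\|\to0\quad\text{as }k\to\infty .$$ Moreover, unsuccessful iterations in $\mathcal U_2$ do not occur eventually (i.e. $\mathcal U_2$ contains no index $k$ sufficiently large).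
   Context: $\|\cdot\|$ is the Euclidean vector norm and the induced matrix norm. For a symmetric matrix $B_k\in\mathbb{R}^{n\times n}$ and $\sigma_k>0$ let $$T_2(x_k,s)=f(x_k)+\nabla f(x_k)^Ts+\tfrac12 s^TB_ks,\quad m(x_k,s,\sigma_k)=T_2(x_k,s)+\tfrac{\sigma_k}{3}\|s\|^3,\quad \rho_k=\frac{f(x_k)-f(x_k+s_k)}{T_2(x_k,0)-T_2(x_k,s_k)} .$$ ALGORITHM (ARC with dynamic Hessian accuracy; the termination test is disregarded here, so that infinite sequences are generated). Step 0. Given $x_0\in\mathbb{R}^n$, $\sigma_0>0$, and parameters $0<\theta<1$, $\alpha\in[0,\frac23)$, $\sigma_{\min}\in(0,\sigma_0]$, $0<\eta_1\le\eta_2<\frac{2-3\alpha}{2}$, $0<\gamma_1<1<\gamma_2<\gamma_3$, $C>0$. Set $k=0$, $C_0=C$, flag $=1$. Step 2. Compute a symmetric $B_k$ with $\|\nabla^2 f(x_k)-B_k\|\le C_k$. Step 3. Choose $\theta_k\le\theta$ and compute $s_k$ with $m(x_k,s_k,\sigma_k)<m(x_k,0,\sigma_k)$ and $\|\nabla_s m(x_k,s_k,\sigma_k)\|\le\theta_k\|\nabla f(x_k)\|$. Step 4. If $\|s_k\|<1$ and flag $=1$ and $C>\alpha(1-\theta)\|\nabla f(x_k)\|$: set $x_{k+1}=x_k$, $\sigma_{k+1}=\sigma_k$ (unsuccessful iteration in the sense of Step 4), $C_{k+1}=\alpha(1-\theta)\|\nabla f(x_k)\|$, flag $=0$, increment $k$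 by one and go to Step 2. Step 5. Compute $\rho_k$. If $\rho_k\ge\eta_1$ (successful iteration): set $x_{k+1}=x_k+s_k$; choose $\sigma_{k+1}\in[\max(\sigma_{\min},\gamma_1\sigma_k),\sigma_k]$ if $\rho_k\ge\eta_2$ (very successful), $\sigma_{k+1}\in[\sigma_k,\gamma_2\sigma_k]$ if $\rho_k\in[\eta_1,\eta_2)$; if $\|s_k\|\ge1$ set $C_{k+1}=C$, flag $=1$, otherwise set $C_{k+1}=\alpha(1-\theta)\|\nabla f(x_{k+1})\|$, flag $=0$; increment $k$ and go to Step 2. If $\rho_k<\eta_1$ (unsuccessful iteration in the sense of Step 5): set $x_{k+1}=x_k$, choose $\sigma_{k+1}\in[\gamma_2\sigma_k,\gamma_3\sigma_k]$, set $C_{k+1}=C_k$, $B_{k+1}=B_k$, increment $k$ and go to Step 3. $\mathcal S$ is the set of successful (including very successful) iterations, $\mathcal U_1$ the set of iterations unsuccessful in the sense of Step 5, $\mathcal U_2$ the set of iterations unsuccessful in the sense of Step 4. Standing accuracy property: at every iteration $k\in\mathcal S\cup\mathcal U_1$ one has $\|\nabla^2 f(x_k)-B_k\|\le C$ if $\|s_k\|\ge1$, and $\|\nabla^2 f(x_k)-B_k\|\le\alpha(1-\theta)\|\nabla f(x_k)\|$ if $\|s_k\|<1$. *)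

theory Defs
  imports "HOL-Analysis.Analysis"
begin

definition gradient :: "('a::euclidean_space \<Rightarrow> real) \<Rightarrow> 'a \<Rightarrow> 'a" where
  "gradient F x = (THE d. GDERIV F x :> d)"

definition hessian :: "(real^'n \<Rightarrow> real) \<Rightarrow> real^'n \<Rightarrow> real^'n^'n" where
  "hessian F x = jacobian (gradient F) (at x)"

definition twice_cont_diff :: "(real^'n \<Rightarrow> real) \<Rightarrow> bool" where
  "twice_cont_diff F \<longleftrightarrow>
     (\<forall>x. F differentiable (at x)) \<and>
     (\<forall>x. gradient F differentiable (at x)) \<and>
     continuous_on UNIV (hessian F)"

(* The library norm on real^'n^'n is the Frobenius norm; this is the norm induced by the
   Euclidean vector norm. *)
definition mat_norm :: "real^'n^'n \<Rightarrow> real" where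
  "mat_norm A = onorm (\<lambda>v. A *v v)"

definition taylor2 :: "(real^'n \<Rightarrow> real) \<Rightarrow> real^'n \<Rightarrow> real^'n^'n \<Rightarrow> real^'n \<Rightarrow> real" where
  "taylor2 f x B s = f x + gradient f x \<bullet> s + (1/2) * (s \<bullet> (B *v s))"

definition cubic_model ::
  "(real^'n \<Rightarrow> real) \<Rightarrow> real^'n \<Rightarrow> real^'n^'n \<Rightarrow> real \<Rightarrow> real^'n \<Rightarrow> real" where
  "cubic_model f x B \<sigma> s = taylor2 f x B s + (\<sigma> / 3) * norm s ^ 3"

definition decrease_ratio ::
  "(real^'n \<Rightarrow> real) \<Rightarrow> real^'n \<Rightarrow> real^'n^'n \<Rightarrow> real^'n \<Rightarrow> real" where
  "decrease_ratio f x B s = (f x - f (x + s)) / (taylor2 f x B 0 - taylor2 f x B s)"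

record arc_params =
  theta :: real
  alpha :: real
  sigma_min :: real
  eta1 :: real
  eta2 :: real
  gamma1 :: real
  gamma2 :: real
  gamma3 :: real
  acc_const :: real

definition valid_params :: "arc_params \<Rightarrow> bool" where
  "valid_params p \<longleftrightarrow>
     0 < theta p \<and> theta p < 1 \<and>
     0 \<le> alpha p \<and> alpha p < 2/3 \<and>
     0 < sigma_min p \<and>
     0 < eta1 p \<and> eta1 p \<le> eta2 p \<and> eta2 p < (2 - 3 * alpha p) / 2 \<and>
     0 < gamma1 p \<and> gamma1 p < 1 \<and> 1 < gamma2 p \<and> gamma2 p < gamma3 p \<and>
     0 < acc_const p"

definition tight_acc :: "arc_params \<Rightarrow> (real^'n \<Rightarrow> real) \<Rightarrow> real^'n \<Rightarrow> real" where
  "tight_acc p f x = alpha p * (1 - theta p) * norm (gradient f x)"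

(* A run is given by sequences x, s, B, sig (regularisation parameter), th (the theta_k), Ck and
   flag; Ck k and flag k are the values in force at the start of iteration k, and flag k = True
   encodes flag = 1. The test of Step 4 compares with the constant C, not with C_k. *)

definition U2_iters ::
  "arc_params \<Rightarrow> (real^'n \<Rightarrow> real) \<Rightarrow> (nat \<Rightarrow> real^'n) \<Rightarrow> (nat \<Rightarrow> real^'n)
     \<Rightarrow> (nat \<Rightarrow> bool) \<Rightarrow> nat set" where
  "U2_iters p f x s flag =
     {k. norm (s k) < 1 \<and> flag k \<and> acc_const p > tight_acc p f (x k)}"

definition S_iters ::
  "arc_params \<Rightarrow> (real^'n \<Rightarrow> real) \<Rightarrow> (nat \<Rightarrow> real^'n) \<Rightarrow> (nat \<Rightarrow> real^'n)
     \<Rightarrow> (nat \<Rightarrow> real^'n^'n) \<Rightarrow> (nat \<Rightarrow> bool) \<Rightarrow> nat set" where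
  "S_iters p f x s B flag =
     {k. k \<notin> U2_iters p f x s flag \<and> decrease_ratio f (x k) (B k) (s k) \<ge> eta1 p}"

definition U1_iters ::
  "arc_params \<Rightarrow> (real^'n \<Rightarrow> real) \<Rightarrow> (nat \<Rightarrow> real^'n) \<Rightarrow> (nat \<Rightarrow> real^'n)
     \<Rightarrow> (nat \<Rightarrow> real^'n^'n) \<Rightarrow> (nat \<Rightarrow> bool) \<Rightarrow> nat set" where
  "U1_iters p f x s B flag =
     {k. k \<notin> U2_iters p f x s flag \<and> decrease_ratio f (x k) (B k) (s k) < eta1 p}"

definition step2 ::
  "(real^'n \<Rightarrow> real) \<Rightarrow> real^'n \<Rightarrow> real^'n^'n \<Rightarrow> real \<Rightarrow> bool" where
  "step2 f x B c \<longleftrightarrow> transpose B = B \<and> mat_norm (hessian f x - B) \<le> c"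

locale arc_run =
  fixes p :: arc_params
    and f :: "real^'n \<Rightarrow> real"
    and x s :: "nat \<Rightarrow> real^'n"
    and B :: "nat \<Rightarrow> real^'n^'n"
    and sig th Ck :: "nat \<Rightarrow> real"
    and flag :: "nat \<Rightarrow> bool"
  assumes params: "valid_params p"
    and init: "sigma_min p \<le> sig 0" "Ck 0 = acc_const p" "flag 0" "step2 f (x 0) (B 0) (Ck 0)"
    and step3: "\<And>k. th k \<le> theta p"
      "\<And>k. cubic_model f (x k) (B k) (sig k) (s k) < cubic_model f (x k) (B k) (sig k) 0"
      "\<And>k. norm (gradient (cubic_model f (x k) (B k) (sig k)) (s k))
             \<le> th k * norm (gradient f (x k))"
    and step4: "\<And>k. k \<in> U2_iters p f x s flag \<Longrightarrow>
      x (Suc k) = x k \<and> sig (Suc k) = sig k \<and>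
      Ck (Suc k) = tight_acc p f (x k) \<and> \<not> flag (Suc k) \<and>
      step2 f (x (Suc k)) (B (Suc k)) (Ck (Suc k))"
    and step5_successful: "\<And>k. k \<in> S_iters p f x s B flag \<Longrightarrow>
      x (Suc k) = x k + s k \<and>
      (if decrease_ratio f (x k) (B k) (s k) \<ge> eta2 p
       then sig (Suc k) \<in> {max (sigma_min p) (gamma1 p * sig k) .. sig k}
       else sig (Suc k) \<in> {sig k .. gamma2 p * sig k}) \<and>
      (if norm (s k) \<ge> 1
       then Ck (Suc k) = acc_const p \<and> flag (Suc k)
       else Ck (Suc k) = tight_acc p f (x (Suc k)) \<and> \<not> flag (Suc k)) \<and>
      step2 f (x (Suc k)) (B (Suc k)) (Ck (Suc k))"
    and step5_unsuccessful: "\<And>k. k \<in> U1_iters p f x s B flag \<Longrightarrow>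
      x (Suc k) = x k \<and> sig (Suc k) \<in> {gamma2 p * sig k .. gamma3 p * sig k} \<and>
      Ck (Suc k) = Ck k \<and> flag (Suc k) = flag k \<and> B (Suc k) = B k"

(* Not a consequence of the algorithm: after a successful short step, C_{k+1} may exceed C while
   the next step is long. *)
definition standing_accuracy ::
  "arc_params \<Rightarrow> (real^'n \<Rightarrow> real) \<Rightarrow> (nat \<Rightarrow> real^'n) \<Rightarrow> (nat \<Rightarrow> real^'n)
     \<Rightarrow> (nat \<Rightarrow> real^'n^'n) \<Rightarrow> (nat \<Rightarrow> bool) \<Rightarrow> bool" where
  "standing_accuracy p f x s B flag \<longleftrightarrow>
     (\<forall>k \<in> S_iters p f x s B flag \<union> U1_iters p f x s B flag.
        (norm (s k) \<ge> 1 \<longrightarrow> mat_norm (hessian f (x k) - B k) \<le> acc_const p) \<and>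
        (norm (s k) < 1 \<longrightarrow> mat_norm (hessian f (x k) - B k) \<le> tight_acc p f (x k)))"

end

theory Submission
  imports Defs
begin

text \<open>
  A step that decreases the cubic model decreases the quadratic model by more than
  \<open>\<sigma>/3 \<parallel>s\<parallel>\<^sup>3\<close>, so a successful iteration decreases \<open>f\<close> by at least a fixed multiple of
  \<open>\<parallel>s\<parallel>\<^sup>3\<close>, since \<open>\<sigma>\<close> never falls below \<open>\<sigma>_min\<close>. As \<open>f\<close> is bounded below, the successful steps
  tend to zero (\<open>successful_steps_tendsto_0\<close>). Hence long successful steps stop. They are the only
  iterations that raise the flag, every iteration in \<open>\<U>\<^sub>2\<close> lowers it, and one in \<open>\<U>\<^sub>2\<close> needs it
  raised: at most one such iteration follows the last long step (\<open>U2_eventually_absent\<close>).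

  The gradient condition on the step bounds the gradient by the step,
  \<open>(1 - \<theta>) \<parallel>\<nabla>f(x)\<parallel> \<le> \<parallel>B\<parallel> \<parallel>s\<parallel> + \<sigma> \<parallel>s\<parallel>\<^sup>2\<close> (\<open>gradient_le_step\<close>). This is used twice. First, it
  turns the Hessian accuracy, which for short steps is relative to \<open>\<parallel>\<nabla>f(x)\<parallel>\<close>, into one of order
  \<open>\<parallel>s\<parallel>\<close>. The model error is then at most \<open>(M + \<alpha> \<sigma>)/2 \<parallel>s\<parallel>\<^sup>3\<close> with \<open>M\<close> constant; its ratio to
  \<open>\<sigma>/3 \<parallel>s\<parallel>\<^sup>3\<close> tends to \<open>3\<alpha>/2 < 1 - \<eta>\<^sub>2\<close> as \<open>\<sigma>\<close> grows, which is where the upper limit on \<open>\<eta>\<^sub>2\<close> comes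
  from. So large \<open>\<sigma>\<close> forces a very successful iteration, and \<open>\<sigma>\<close> is bounded (\<open>sig_bounded\<close>).
  Consequently there are infinitely many successful iterations: otherwise all late iterations would
  lie in \<open>\<U>\<^sub>1\<close> and \<open>\<sigma>\<close> would grow geometrically. Second, with \<open>\<sigma>\<close> and \<open>B\<close> bounded, it gives
  \<open>\<nabla>f(x\<^sub>k) \<rightarrow> 0\<close> along the successful iterations, and since the iterate does not move between
  them, along the whole sequence.
\<close>

section \<open>Calculus of the objective and of the cubic model\<close>

lemma gradient_eqI:
  assumes "GDERIV F x :> d"
  shows "gradient F x = d"
proof -
  have "d' = d" if "GDERIV F x :> d'" for d'
  proof -
    have "(\<lambda>h. h \<bullet> d') = (\<lambda>h. h \<bullet> d)"
      using has_derivative_unique that assms unfolding gderiv_def by blast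
    then show ?thesis
      by (metis vector_eq_ldot)
  qed
  then show ?thesis
    unfolding gradient_def using assms by blast
qed

lemma GDERIV_gradient:
  assumes "F differentiable (at x)"
  shows "GDERIV F x :> gradient F x"
proof -
  obtain F' where F': "(F has_derivative F') (at x)"
    using assms unfolding differentiable_def by blast
  interpret F': bounded_linear F' using F' by (rule has_derivative_bounded_linear)
  have "F' h = h \<bullet> (\<Sum>b\<in>Basis. F' b *\<^sub>R b)" for h
  proof -
    have "F' h = F' (\<Sum>b\<in>Basis. (h \<bullet> b) *\<^sub>R b)"
      by (simp add: euclidean_representation)
    also have "\<dots> = h \<bullet> (\<Sum>b\<in>Basis. F' b *\<^sub>R b)"
      by (simp add: F'.sum F'.scaleR inner_sum_right mult.commute)
    finally show ?thesis .
  qed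
  then have "F' = (\<lambda>h. h \<bullet> (\<Sum>b\<in>Basis. F' b *\<^sub>R b))" ..
  then have "GDERIV F x :> (\<Sum>b\<in>Basis. F' b *\<^sub>R b)"
    unfolding gderiv_def using F' by metis
  then show ?thesis
    by (simp add: gradient_eqI)
qed

lemma norm_matrix_vector_le: "norm (A *v v) \<le> mat_norm A * norm v"
  unfolding mat_norm_def by (simp add: onorm)

lemma quadratic_form_le: "v \<bullet> (A *v v) \<le> mat_norm A * norm v ^ 2"
proof -
  have "v \<bullet> (A *v v) \<le> norm v * norm (A *v v)"
    by (rule norm_cauchy_schwarz)
  also have "\<dots> \<le> norm v * (mat_norm A * norm v)"
    by (simp add: norm_matrix_vector_le mult_left_mono)
  finally show ?thesis
    by (simp add: power2_eq_square mult_ac)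
qed

text \<open>The derivative of \<open>\<parallel>v\<parallel>\<^sup>3\<close> comes from that of \<open>\<parallel>v\<parallel>\<close> by the chain rule, which needs \<open>v \<noteq> 0\<close>;
  steps of a run are never zero. Symmetry makes \<open>A v\<close> the gradient of the quadratic term.\<close>

lemma gradient_cubic_model:
  assumes sym: "transpose A = A" and "v \<noteq> 0"
  shows "gradient (cubic_model f y A \<sigma>) v = gradient f y + A *v v + (\<sigma> * norm v) *\<^sub>R v"
proof (rule gradient_eqI)
  have swap: "v \<bullet> (A *v h) = h \<bullet> (A *v v)" for h
    by (metis dot_lmul_matrix inner_commute sym vector_transpose_matrix)
  have A: "((\<lambda>v. A *v v) has_derivative (\<lambda>h. A *v h)) (at v)"
    by (rule bounded_linear.has_derivative[OF matrix_vector_mul_bounded_linear has_derivative_ident])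
  have N: "(norm has_derivative (\<lambda>h. h \<bullet> sgn v)) (at v)"
    using GDERIV_norm[OF \<open>v \<noteq> 0\<close>] unfolding gderiv_def .
  have "(cubic_model f y A \<sigma> has_derivative
      (\<lambda>h. gradient f y \<bullet> h + (1/2) * (v \<bullet> (A *v h) + h \<bullet> (A *v v))
            + (\<sigma> / 3) * (3 * norm v ^ 2 * (h \<bullet> sgn v)))) (at v)"
    unfolding cubic_model_def taylor2_def
    by (rule derivative_eq_intros A N refl | simp add: mult_ac)+
  moreover have "norm v ^ 2 * (h \<bullet> sgn v) = norm v * (h \<bullet> v)" for h
    using \<open>v \<noteq> 0\<close> by (simp add: sgn_div_norm power2_eq_square)
  ultimately show "GDERIV (cubic_model f y A \<sigma>) v :> gradient f y + A *v v + (\<sigma> * norm v) *\<^sub>R v"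
    unfolding gderiv_def
    by (simp add: swap inner_commute[of "gradient f y"] algebra_simps)
qed

text \<open>Taylor's theorem with Lagrange remainder along the segment from \<open>y\<close> to \<open>y + v\<close>. Writing the
  remainder through \<open>taylor2\<close> with the Hessian at the intermediate point makes \<open>f\<close> and its model
  differ in the quadratic term only.\<close>

lemma second_order_mean_value:
  fixes f :: "real^'n \<Rightarrow> real"
  assumes "twice_cont_diff f"
  shows "\<exists>\<beta>\<in>{0..1}. f (y + v) = taylor2 f y (hessian f (y + \<beta> *\<^sub>R v)) v"
proof -
  define D where "D m t = (if m = 0 then f (y + t *\<^sub>R v)
      else if m = 1 then gradient f (y + t *\<^sub>R v) \<bullet> v
      else v \<bullet> (hessian f (y + t *\<^sub>R v) *v v))" for m :: nat and t
  have line: "((\<lambda>t. y + t *\<^sub>R v) has_derivative (\<lambda>h. h *\<^sub>R v)) (at t)" for t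
    by (auto intro!: derivative_eq_intros)
  have D0: "DERIV (D 0) t :> D 1 t" for t
  proof -
    have "(f has_derivative (\<lambda>h. h \<bullet> gradient f (y + t *\<^sub>R v))) (at (y + t *\<^sub>R v))"
      using GDERIV_gradient assms unfolding twice_cont_diff_def gderiv_def by blast
    from has_derivative_compose[OF line this] show ?thesis
      unfolding D_def has_field_derivative_def
      by (simp add: inner_commute mult_commute_abs)
  qed
  have D1: "DERIV (D 1) t :> D 2 t" for t
  proof -
    have "(gradient f has_derivative (\<lambda>h. hessian f (y + t *\<^sub>R v) *v h)) (at (y + t *\<^sub>R v))"
      using assms unfolding twice_cont_diff_def hessian_def by (simp add: jacobian_works)
    from has_derivative_inner_left[OF has_derivative_compose[OF line this], of v] show ?thesis
      unfolding D_def has_field_derivative_def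
      by (simp add: inner_commute matrix_vector_mult_scaleR mult_commute_abs)
  qed
  have "DERIV (D m) t :> D (Suc m) t" if "m < 2" for m t
    using less_2_cases[OF that] D0[of t] D1[of t] by (auto simp: numeral_2_eq_2)
  then have "\<exists>t>0. t < 1 \<and> D 0 1 = (\<Sum>m<2. D m 0 / fact m * 1 ^ m) + D 2 t / fact 2 * 1 ^ 2"
    by (intro Maclaurin) auto
  then obtain t where "0 < t" "t < 1" "D 0 1 = D 0 0 + D 1 0 + D 2 t / 2"
    by (auto simp: numeral_2_eq_2)
  then show ?thesis
    by (intro bexI[of _ t]) (auto simp: D_def taylor2_def)
qed

section \<open>Invariants of a run\<close>

context arc_run
begin

lemma iteration_cases:
  obtains "k \<in> U2_iters p f x s flag" | "k \<in> S_iters p f x s B flag"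
    | "k \<in> U1_iters p f x s B flag"
  unfolding S_iters_def U1_iters_def by fastforce

lemma transpose_B: "transpose (B k) = B k"
proof (induction k)
  case 0
  then show ?case using init by (simp add: step2_def)
next
  case (Suc k)
  then show ?case
    by (cases k rule: iteration_cases)
       (use step4[of k] step5_successful[of k] step5_unsuccessful[of k] in \<open>simp_all add: step2_def\<close>)
qed

lemma sig_ge_sigma_min: "sigma_min p \<le> sig k"
proof (induction k)
  case 0
  then show ?case using init by simp
next
  case (Suc k)
  have "1 * sig k \<le> gamma2 p * sig k"
    using Suc params by (intro mult_right_mono) (auto simp: valid_params_def)
  with Suc show ?case
    by (cases k rule: iteration_cases)
       (use step4[of k] step5_successful[of k] step5_unsuccessful[of k] in \<open>auto split: if_splits\<close>)
qed

lemma sig_pos: "0 < sig k"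
  using sig_ge_sigma_min[of k] params by (simp add: valid_params_def)

lemma step_nonzero: "s k \<noteq> 0"
  using step3(2)[of k] by auto

lemma taylor_decrease:
  "sig k / 3 * norm (s k) ^ 3 < taylor2 f (x k) (B k) 0 - taylor2 f (x k) (B k) (s k)"
  using step3(2)[of k] by (simp add: cubic_model_def)

lemma taylor_decrease_pos: "0 < taylor2 f (x k) (B k) 0 - taylor2 f (x k) (B k) (s k)"
proof -
  have "0 \<le> sig k / 3 * norm (s k) ^ 3" using sig_pos[of k] by simp
  with taylor_decrease[of k] show ?thesis by linarith
qed

text \<open>The gradient of the model at the step is \<open>\<nabla>f(x) + B s + \<sigma> \<parallel>s\<parallel> s\<close>. It is small relative to
  \<open>\<nabla>f(x)\<close>, so the last two terms have to compensate most of \<open>\<nabla>f(x)\<close>.\<close>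

lemma gradient_le_step:
  "(1 - theta p) * norm (gradient f (x k))
     \<le> mat_norm (B k) * norm (s k) + sig k * norm (s k) ^ 2"
proof -
  let ?g = "gradient f (x k)" and ?m = "gradient (cubic_model f (x k) (B k) (sig k)) (s k)"
  have "?g = ?m - B k *v s k - (sig k * norm (s k)) *\<^sub>R s k"
    by (simp add: gradient_cubic_model transpose_B step_nonzero)
  then have "norm ?g = norm (?m - B k *v s k - (sig k * norm (s k)) *\<^sub>R s k)"
    by simp
  then have "norm ?g \<le> norm ?m + norm (B k *v s k) + norm ((sig k * norm (s k)) *\<^sub>R s k)"
    using norm_triangle_ineq4[of "?m - B k *v s k" "(sig k * norm (s k)) *\<^sub>R s k"]
      norm_triangle_ineq4[of ?m "B k *v s k"] by linarith
  moreover have "norm ?m \<le> theta p * norm ?g"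
    using step3(3)[of k] mult_right_mono[OF step3(1)[of k] norm_ge_zero[of ?g]] by linarith
  moreover have "norm ((sig k * norm (s k)) *\<^sub>R s k) = sig k * norm (s k) ^ 2"
    using sig_pos[of k] by (simp add: power2_eq_square)
  ultimately show ?thesis
    using norm_matrix_vector_le[of "B k" "s k"] by (simp add: algebra_simps)
qed

lemma successful_decrease:
  assumes "k \<in> S_iters p f x s B flag"
  shows "eta1 p * sigma_min p / 3 * norm (s k) ^ 3 \<le> f (x k) - f (x (Suc k))"
proof -
  let ?T = "taylor2 f (x k) (B k) 0 - taylor2 f (x k) (B k) (s k)"
  have eta: "0 < eta1 p" using params by (simp add: valid_params_def)
  have "sigma_min p / 3 * norm (s k) ^ 3 \<le> sig k / 3 * norm (s k) ^ 3"
    using sig_ge_sigma_min[of k] by (intro mult_right_mono) auto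
  also have "\<dots> \<le> ?T" using taylor_decrease[of k] by simp
  finally have "eta1 p * (sigma_min p / 3 * norm (s k) ^ 3) \<le> eta1 p * ?T"
    using eta by (intro mult_left_mono) auto
  also have "\<dots> \<le> f (x k) - f (x k + s k)"
    using assms taylor_decrease_pos[of k]
    by (simp add: S_iters_def decrease_ratio_def pos_le_divide_eq)
  also have "\<dots> = f (x k) - f (x (Suc k))"
    using step5_successful[OF assms] by simp
  finally show ?thesis by simp
qed

lemma unsuccessful_x: "k \<notin> S_iters p f x s B flag \<Longrightarrow> x (Suc k) = x k"
  using step4[of k] step5_unsuccessful[of k] by (cases k rule: iteration_cases) auto

section \<open>Vanishing steps\<close>

text \<open>The values \<open>f (x k)\<close> decrease to a limit, so their differences vanish, and on successful
  iterations the differences dominate a multiple of the cubed step length.\<close>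

lemma successful_steps_tendsto_0:
  assumes "\<forall>y. f_low \<le> f y"
  shows "((\<lambda>k. norm (s k)) \<longlongrightarrow> 0) (inf sequentially (principal (S_iters p f x s B flag)))"
proof (rule tendstoI)
  fix e :: real assume "0 < e"
  define c where "c = eta1 p * sigma_min p / 3"
  have c: "0 < c" using params by (simp add: c_def valid_params_def)
  have "f (x (Suc k)) \<le> f (x k)" for k
  proof (cases "k \<in> S_iters p f x s B flag")
    case True
    have "0 \<le> c * norm (s k) ^ 3" using c by simp
    with successful_decrease[OF True] show ?thesis by (simp add: c_def)
  qed (simp add: unsuccessful_x)
  then have "decseq (\<lambda>k. f (x k))" by (rule decseq_SucI)
  then obtain l where l: "(\<lambda>k. f (x k)) \<longlonglongrightarrow> l"
    using decseq_convergent assms by blast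
  have "(\<lambda>k. f (x k) - f (x (Suc k))) \<longlonglongrightarrow> l - l"
    by (intro tendsto_diff l LIMSEQ_Suc)
  then have "\<forall>\<^sub>F k in sequentially. f (x k) - f (x (Suc k)) < c * e ^ 3"
    using c \<open>0 < e\<close> by (intro order_tendstoD(2)) auto
  then have "\<forall>\<^sub>F k in sequentially. k \<in> S_iters p f x s B flag \<longrightarrow> norm (s k) < e"
  proof (rule eventually_mono, intro impI)
    fix k assume less: "f (x k) - f (x (Suc k)) < c * e ^ 3" and k: "k \<in> S_iters p f x s B flag"
    have "c * norm (s k) ^ 3 < c * e ^ 3"
      using successful_decrease[OF k] less by (simp add: c_def)
    then have "norm (s k) ^ 3 < e ^ 3" using c by simp
    then show "norm (s k) < e" using \<open>0 < e\<close> power_less_imp_less_base[of "norm (s k)" 3 e] by simp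
  qed
  then show "\<forall>\<^sub>F k in inf sequentially (principal (S_iters p f x s B flag)). dist (norm (s k)) 0 < e"
    by (simp add: eventually_inf_principal)
qed

text \<open>Once no successful step is long, a lowered flag stays lowered; the first later iteration in
  \<open>\<U>\<^sub>2\<close> lowers it and is therefore the last.\<close>

lemma U2_eventually_absent:
  assumes "\<forall>y. f_low \<le> f y"
  shows "\<exists>K. \<forall>k\<ge>K. k \<notin> U2_iters p f x s flag"
proof -
  have "\<forall>\<^sub>F k in sequentially. k \<in> S_iters p f x s B flag \<longrightarrow> norm (s k) < 1"
    using order_tendstoD(2)[OF successful_steps_tendsto_0[OF assms], of 1]
    by (simp add: eventually_inf_principal)
  then obtain N where N: "\<And>k. k \<ge> N \<Longrightarrow> k \<in> S_iters p f x s B flag \<Longrightarrow> norm (s k) < 1"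
    by (auto simp: eventually_sequentially)
  have keep: "\<not> flag (Suc k)" if "k \<ge> N" "\<not> flag k" for k
  proof (cases k rule: iteration_cases)
    case 2
    then show ?thesis using N[OF that(1)] step5_successful[of k] by simp
  qed (use that step4[of k] step5_unsuccessful[of k] in simp_all)
  show ?thesis
  proof (cases "\<exists>k\<ge>N. k \<in> U2_iters p f x s flag")
    case True
    then obtain k where k: "k \<ge> N" "k \<in> U2_iters p f x s flag" by blast
    have "\<not> flag j" if "j \<ge> Suc k" for j
      using that
    proof (induction rule: dec_induct)
      case base
      then show ?case using step4[OF k(2)] by simp
    next
      case (step j)
      then show ?case using keep[of j] k by simp
    qed
    then show ?thesis
      by (intro exI[of _ "Suc k"]) (auto simp: U2_iters_def)
  qed blast
qed

end

section \<open>Boundedness of the regularisation parameter\<close>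

locale accurate_arc_run = arc_run p f x s B sig th Ck flag
  for p :: arc_params and f :: "real^'n \<Rightarrow> real" and x s :: "nat \<Rightarrow> real^'n"
    and B :: "nat \<Rightarrow> real^'n^'n" and sig th Ck :: "nat \<Rightarrow> real" and flag :: "nat \<Rightarrow> bool" +
  fixes L \<kappa>_B :: real
  assumes smooth: "twice_cont_diff f"
    and accuracy: "standing_accuracy p f x s B flag"
    and Lipschitz: "\<And>k \<beta>. \<beta> \<in> {0..1} \<Longrightarrow>
      mat_norm (hessian f (x k + \<beta> *\<^sub>R s k) - hessian f (x k)) \<le> L * \<beta> * norm (s k)"
    and L_pos: "0 < L"
    and B_bound: "\<And>k. mat_norm (B k) \<le> \<kappa>_B"
begin

lemma \<kappa>_B_nonneg: "0 \<le> \<kappa>_B"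
  using B_bound[of 0] onorm_pos_le[of "\<lambda>v. B 0 *v v"] by (simp add: mat_norm_def)

text \<open>The difference of the quadratic terms splits at the exact Hessian at \<open>x k\<close>: Lipschitz continuity
  along the step controls one part, the inaccuracy of \<open>B k\<close> the other.\<close>

lemma taylor_error:
  "f (x k + s k) - taylor2 f (x k) (B k) (s k)
     \<le> 1/2 * (L * norm (s k) ^ 3 + mat_norm (hessian f (x k) - B k) * norm (s k) ^ 2)"
proof -
  let ?H = "hessian f" and ?q = "\<lambda>A. s k \<bullet> (A *v s k)"
  obtain \<beta> where \<beta>: "\<beta> \<in> {0..1}"
    and mv: "f (x k + s k) = taylor2 f (x k) (?H (x k + \<beta> *\<^sub>R s k)) (s k)"
    using second_order_mean_value[OF smooth] by blast
  have "?q (?H (x k + \<beta> *\<^sub>R s k)) - ?q (B k)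
      = ?q (?H (x k + \<beta> *\<^sub>R s k) - ?H (x k)) + ?q (?H (x k) - B k)"
    by (simp add: matrix_vector_mult_diff_rdistrib inner_diff_right)
  moreover have "?q (?H (x k + \<beta> *\<^sub>R s k) - ?H (x k)) \<le> L * norm (s k) ^ 3"
  proof -
    have "L * \<beta> * norm (s k) \<le> L * 1 * norm (s k)"
      using \<beta> L_pos by (intro mult_right_mono mult_left_mono) auto
    with Lipschitz[OF \<beta>, of k]
    have "mat_norm (?H (x k + \<beta> *\<^sub>R s k) - ?H (x k)) * norm (s k) ^ 2
        \<le> L * 1 * norm (s k) * norm (s k) ^ 2"
      by (intro mult_right_mono) auto
    then show ?thesis
      using quadratic_form_le[of "s k" "?H (x k + \<beta> *\<^sub>R s k) - ?H (x k)"]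
      by (simp add: power2_eq_square power3_eq_cube mult_ac)
  qed
  moreover have "?q (?H (x k) - B k) \<le> mat_norm (?H (x k) - B k) * norm (s k) ^ 2"
    by (rule quadratic_form_le)
  ultimately show ?thesis
    by (simp add: mv taylor2_def)
qed

text \<open>For a long step the absolute accuracy \<open>C\<close> is at most \<open>C \<parallel>s\<parallel>\<close>. For a short one the accuracy is
  \<open>\<alpha> (1 - \<theta>) \<parallel>\<nabla>f(x)\<parallel>\<close>, which the step bounds by \<open>gradient_le_step\<close>; there \<open>\<parallel>s\<parallel>\<^sup>2 \<le> \<parallel>s\<parallel>\<close>. The
  single coefficient below covers both cases.\<close>

lemma hessian_error_le_step:
  assumes "k \<notin> U2_iters p f x s flag"
  shows "mat_norm (hessian f (x k) - B k)
    \<le> (acc_const p + alpha p * \<kappa>_B + alpha p * sig k) * norm (s k)"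
proof -
  have nn: "0 \<le> acc_const p" "0 \<le> alpha p" "0 \<le> sig k"
    using params sig_pos[of k] by (auto simp: valid_params_def)
  have SU: "k \<in> S_iters p f x s B flag \<union> U1_iters p f x s B flag"
    using assms by (cases k rule: iteration_cases) auto
  show ?thesis
  proof (cases "norm (s k) \<ge> 1")
    case True
    have "mat_norm (hessian f (x k) - B k) \<le> acc_const p"
      using accuracy SU True unfolding standing_accuracy_def by blast
    also have "\<dots> \<le> acc_const p * norm (s k)"
      using True nn by (simp add: mult_le_cancel_left1)
    also have "\<dots> \<le> (acc_const p + alpha p * \<kappa>_B + alpha p * sig k) * norm (s k)"
      using nn \<kappa>_B_nonneg by (intro mult_right_mono) auto
    finally show ?thesis .
  next
    case False
    have "mat_norm (hessian f (x k) - B k) \<le> tight_acc p f (x k)"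
      using accuracy SU False unfolding standing_accuracy_def by fastforce
    also have "\<dots> = alpha p * ((1 - theta p) * norm (gradient f (x k)))"
      by (simp add: tight_acc_def)
    also have "\<dots> \<le> alpha p * (mat_norm (B k) * norm (s k) + sig k * norm (s k) ^ 2)"
      using nn gradient_le_step by (intro mult_left_mono)
    also have "\<dots> \<le> alpha p * (\<kappa>_B * norm (s k) + sig k * norm (s k))"
      using nn B_bound False
      by (intro mult_left_mono add_mono mult_right_mono)
         (auto simp: power2_eq_square mult_left_le_one_le)
    also have "\<dots> \<le> (acc_const p + alpha p * \<kappa>_B + alpha p * sig k) * norm (s k)"
      using nn by (simp add: algebra_simps)
    finally show ?thesis .
  qed
qed

text \<open>The solution \<open>\<sigma>\<close> of \<open>(L + C + \<alpha> \<kappa>_B + \<alpha> \<sigma>) / 2 = (1 - \<eta>\<^sub>2) \<sigma> / 3\<close>, the value beyond which the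
  model error is at most the fraction \<open>1 - \<eta>\<^sub>2\<close> of the model decrease. The denominator is positive
  exactly because \<open>\<eta>\<^sub>2 < (2 - 3\<alpha>)/2\<close>.\<close>

definition sig_crit :: real where
  "sig_crit = 3 * (L + acc_const p + alpha p * \<kappa>_B) / (2 - 3 * alpha p - 2 * eta2 p)"

lemma very_successful_if_sig_large:
  assumes "k \<notin> U2_iters p f x s flag" and "sig_crit \<le> sig k"
  shows "eta2 p \<le> decrease_ratio f (x k) (B k) (s k)"
proof -
  let ?T = "taylor2 f (x k) (B k) 0 - taylor2 f (x k) (B k) (s k)"
  let ?M = "L + acc_const p + alpha p * \<kappa>_B" and ?n = "norm (s k) ^ 3"
  have par: "0 \<le> alpha p" "0 < 2 - 3 * alpha p - 2 * eta2 p"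
    using params by (auto simp: valid_params_def)
  have M: "3 * ?M \<le> (2 - 3 * alpha p - 2 * eta2 p) * sig k"
    using assms(2) par by (simp add: sig_crit_def pos_divide_le_eq mult.commute)
  have "mat_norm (hessian f (x k) - B k) * norm (s k) ^ 2
      \<le> (acc_const p + alpha p * \<kappa>_B + alpha p * sig k) * norm (s k) * norm (s k) ^ 2"
    using hessian_error_le_step[OF assms(1)] by (intro mult_right_mono) auto
  then have "f (x k + s k) - taylor2 f (x k) (B k) (s k) \<le> 1/2 * ((?M + alpha p * sig k) * ?n)"
    using taylor_error[of k]
    by (simp add: power2_eq_square power3_eq_cube algebra_simps)
  also have "\<dots> \<le> (1 - eta2 p) * (sig k / 3 * ?n)"
  proof -
    have "(?M + alpha p * sig k) / 2 \<le> (1 - eta2 p) * (sig k / 3)"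
      using M by (simp add: field_simps)
    from mult_right_mono[OF this, of ?n] show ?thesis by (simp add: mult_ac)
  qed
  also have "\<dots> \<le> (1 - eta2 p) * ?T"
    using taylor_decrease[of k] par by (intro mult_left_mono) auto
  finally have "eta2 p * ?T \<le> f (x k) - f (x k + s k)"
    by (simp add: taylor2_def[of f "x k" "B k" 0] algebra_simps)
  then show ?thesis
    using taylor_decrease_pos[of k] by (simp add: decrease_ratio_def pos_le_divide_eq)
qed

text \<open>The parameter increases only from values below \<open>sig_crit\<close>, and then by a factor of at most
  \<open>\<gamma>\<^sub>3\<close>.\<close>

lemma sig_bounded: "sig k \<le> max (sig 0) (gamma3 p * sig_crit)"
proof (induction k)
  case (Suc k)
  have gam: "1 < gamma2 p" "gamma2 p < gamma3 p" "eta1 p \<le> eta2 p"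
    using params by (auto simp: valid_params_def)
  show ?case
  proof (cases "sig (Suc k) \<le> sig k")
    case False
    then have nU2: "k \<notin> U2_iters p f x s flag"
      using step4[of k] by auto
    have "\<not> eta2 p \<le> decrease_ratio f (x k) (B k) (s k)"
    proof
      assume "eta2 p \<le> decrease_ratio f (x k) (B k) (s k)"
      moreover from this have "k \<in> S_iters p f x s B flag"
        using nU2 gam by (simp add: S_iters_def)
      ultimately show False using step5_successful[of k] False by simp
    qed
    then have small: "sig k < sig_crit"
      using very_successful_if_sig_large[OF nU2] by linarith
    have "gamma2 p * sig k \<le> gamma3 p * sig k"
      using gam sig_pos[of k] by simp
    moreover have "gamma3 p * sig k \<le> gamma3 p * sig_crit"
      using gam small by simp
    moreover have "sig (Suc k) \<le> gamma2 p * sig k \<or> sig (Suc k) \<le> gamma3 p * sig k"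
      using nU2 False
      by (cases k rule: iteration_cases)
         (use step5_successful[of k] step5_unsuccessful[of k] in \<open>auto split: if_splits\<close>)
    ultimately show ?thesis by linarith
  qed (use Suc in linarith)
qed simp

section \<open>Vanishing gradients\<close>

text \<open>After the last iterations in \<open>\<S>\<close> and \<open>\<U>\<^sub>2\<close> the parameter would be multiplied by at least
  \<open>\<gamma>\<^sub>2 > 1\<close> in every iteration, against its boundedness.\<close>

lemma infinite_S:
  assumes "\<forall>y. f_low \<le> f y"
  shows "infinite (S_iters p f x s B flag)"
proof
  assume "finite (S_iters p f x s B flag)"
  then obtain M where M: "\<And>k. k \<in> S_iters p f x s B flag \<Longrightarrow> k < M"
    by (meson finite_nat_bounded lessThan_iff subsetD)
  obtain K where K: "\<And>k. k \<ge> K \<Longrightarrow> k \<notin> U2_iters p f x s flag"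
    using U2_eventually_absent[OF assms] by blast
  define N where "N = max M K"
  have gam: "1 < gamma2 p" using params by (simp add: valid_params_def)
  have "gamma2 p ^ j * sig N \<le> sig (N + j)" for j
  proof (induction j)
    case (Suc j)
    have "N + j \<in> U1_iters p f x s B flag"
      using M[of "N + j"] K[of "N + j"]
      by (cases "N + j" rule: iteration_cases) (auto simp: N_def)
    then have "gamma2 p * sig (N + j) \<le> sig (N + Suc j)"
      using step5_unsuccessful by simp
    moreover have "gamma2 p * (gamma2 p ^ j * sig N) \<le> gamma2 p * sig (N + j)"
      using Suc gam by (intro mult_left_mono) auto
    ultimately show ?case by (simp add: mult.assoc)
  qed simp
  then have growth: "gamma2 p ^ j * sig N \<le> max (sig 0) (gamma3 p * sig_crit)" for j
    using sig_bounded order_trans by blast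
  obtain j where "max (sig 0) (gamma3 p * sig_crit) / sig N < gamma2 p ^ j"
    using real_arch_pow[OF gam] by blast
  then show False
    using growth[of j] sig_pos[of N] by (simp add: pos_divide_less_eq del: max_less_iff_conj)
qed

lemma gradient_tendsto_0:
  assumes "\<forall>y. f_low \<le> f y"
  shows "(\<lambda>k. norm (gradient f (x k))) \<longlonglongrightarrow> 0"
proof -
  define M where "M = max (sig 0) (gamma3 p * sig_crit)"
  define S where "S = S_iters p f x s B flag"
  let ?F = "inf sequentially (principal S)"
  have th: "0 < 1 - theta p" using params by (simp add: valid_params_def)
  have s0: "((\<lambda>k. norm (s k)) \<longlongrightarrow> 0) ?F"
    unfolding S_def using assms by (rule successful_steps_tendsto_0)
  have bound: "norm (gradient f (x k)) \<le> (\<kappa>_B * norm (s k) + M * norm (s k) ^ 2) / (1 - theta p)" for k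
  proof -
    have "mat_norm (B k) * norm (s k) + sig k * norm (s k) ^ 2
        \<le> \<kappa>_B * norm (s k) + M * norm (s k) ^ 2"
      using B_bound sig_bounded by (intro add_mono mult_right_mono) (auto simp: M_def)
    with gradient_le_step[of k] show ?thesis
      using th by (simp add: pos_le_divide_eq mult.commute)
  qed
  have "((\<lambda>k. (\<kappa>_B * norm (s k) + M * norm (s k) ^ 2) / (1 - theta p))
      \<longlongrightarrow> (\<kappa>_B * 0 + M * 0 ^ 2) / (1 - theta p)) ?F"
    using th by (intro tendsto_intros s0) auto
  then have "((\<lambda>k. (\<kappa>_B * norm (s k) + M * norm (s k) ^ 2) / (1 - theta p)) \<longlongrightarrow> 0) ?F"
    by simp
  then have gS: "((\<lambda>k. norm (gradient f (x k))) \<longlongrightarrow> 0) ?F"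
    by (rule Lim_null_comparison[rotated]) (simp add: bound)
  show ?thesis
  proof (rule tendstoI)
    fix e :: real assume "0 < e"
    with tendstoD[OF gS] obtain K
      where K: "\<And>k. k \<ge> K \<Longrightarrow> k \<in> S \<Longrightarrow> norm (gradient f (x k)) < e"
      by (auto simp: eventually_inf_principal eventually_sequentially)
    have "norm (gradient f (x k)) < e" if "k \<ge> K" for k
    proof -
      \<comment> \<open>The next successful iteration \<open>j \<ge> k\<close> still starts from \<open>x k\<close>.\<close>
      define j where "j = (LEAST j. j \<ge> k \<and> j \<in> S)"
      have "\<exists>j\<ge>k. j \<in> S"
        using infinite_S[OF assms] unfolding S_def by (meson infinite_nat_iff_unbounded_le)
      then have j: "j \<ge> k" "j \<in> S"
        unfolding j_def by (metis (mono_tags, lifting) LeastI)+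
      have const: "i \<le> j \<Longrightarrow> x i = x k" if "k \<le> i" for i
        using that
      proof (induction rule: dec_induct)
        case (step i)
        have "i \<notin> S" using not_less_Least[of i "\<lambda>j. j \<ge> k \<and> j \<in> S"] step by (auto simp: j_def)
        then show ?case using step unsuccessful_x by (simp add: S_def)
      qed simp
      have "x j = x k" using const[OF j(1)] by simp
      with K[OF order_trans[OF that j(1)] j(2)] show ?thesis by simp
    qed
    then show "\<forall>\<^sub>F k in sequentially. dist (norm (gradient f (x k))) 0 < e"
      by (auto simp: eventually_sequentially)
  qed
qed

end

theorem theorem4p3:
  fixes f :: "real^'n \<Rightarrow> real"
    and x s :: "nat \<Rightarrow> real^'n"
    and B :: "nat \<Rightarrow> real^'n^'n"
    and sig th Ck :: "nat \<Rightarrow> real"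
    and flag :: "nat \<Rightarrow> bool"
    and p :: arc_params
    and f_low L \<kappa>_B :: real
  assumes "twice_cont_diff f"
    and "\<forall>y. f_low \<le> f y"
    and "arc_run p f x s B sig th Ck flag"
    and "standing_accuracy p f x s B flag"
    and "L > 0"
    and "\<kappa>_B \<ge> 0"
    and "\<forall>k. \<forall>\<beta>\<in>{0..1}.
           mat_norm (hessian f (x k + \<beta> *\<^sub>R s k) - hessian f (x k)) \<le> L * \<beta> * norm (s k)"
    and "\<forall>k. mat_norm (B k) \<le> \<kappa>_B"
    and "(\<forall>k. norm (gradient (cubic_model f (x k) (B k) (sig k)) (s k))
                 \<le> theta p * min ((norm (s k))\<^sup>2) (norm (gradient f (x k))))
         \<or>
         ((\<forall>k. norm (gradient (cubic_model f (x k) (B k) (sig k)) (s k))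
                 \<le> theta p * min 1 (norm (s k)) * norm (gradient f (x k)))
          \<and> (\<exists>\<kappa>_H. \<forall>k. \<forall>\<beta>\<in>{0..1}. mat_norm (hessian f (x k + \<beta> *\<^sub>R s k)) \<le> \<kappa>_H))"
  shows "((\<lambda>k. norm (s k)) \<longlongrightarrow> 0) (inf sequentially (principal (S_iters p f x s B flag)))
         \<and> (\<lambda>k. norm (gradient f (x k))) \<longlonglongrightarrow> 0
         \<and> (\<exists>K. \<forall>k\<ge>K. k \<notin> U2_iters p f x s flag)"
proof -
  interpret accurate_arc_run p f x s B sig th Ck flag L \<kappa>_B
    using assms by (auto simp: accurate_arc_run_def accurate_arc_run_axioms_def)
  show ?thesis
    using successful_steps_tendsto_0 gradient_tendsto_0 U2_eventually_absent assms(2) by blast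
qed

end
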